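(* Let $n\ge 2$ be an integer and $\lambda_s,\lambda_e>0$. Then the long-term average freshness of a node in the disconnected network with rate-changing gossip is strictly larger than in the disconnected network with traditional gossip: $$\overline{F}_i^{DC_{\mathrm{RC}}}>\overline{F}_i^{DC_{\mathrm{noRC}}},$$ that is, $$\frac{\lambda_s}{n\lambda_e}\left[1-\left(\frac{\lambda_s}{\lambda_s+\lambda_e}\right)^n\right]>\frac{\lambda_s}{\lambda_s+n\lambda_e}.$$
   Context: A source self-updates according to a Poisson process of rate $\lambda_e$, and $n$ nodes track it, receiving updates only from the source (disconnected network). A node is fresh at time $t$ ($F_i(t)=1$) if it holds the current source version, and stale ($F_i(t)=0$) otherwise; $\overline{F}_i=\limsup_{T\to\infty}\frac1T\mathbb{E}\big[\int_0^T F_i(t)\,dt\big]$. The set $S(t)\subseteq\{1,\dots,n\}$ of fresh nodes is a continuous-time Markov chain with $S(0)=\emptyset$, and $F_i(t)=\mathbb{I}_{\{i\in S(t)\}}$. In both schemes, from any state $S$ the chain jumps to $\emptyset$ at rate $\lambda_e$ (source self-update). - Traditional gossip ($DC_{\mathrm{noRC}}$): from $S$, each $i\notin S$ is added at the fixed rate $\lambda_s/n$. In this case $\overline{F}_i^{DC_{\mathrm{noRC}}}=\frac{\lambda_s}{\lambda_s+n\lambda_e}$. - Rate-changing gossip ($DC_{\mathrm{RC}}$): from $S$ with $|S|<n$, each $i\notin S$ is added at rate $\lambda_s/(n-|S|)$. In this case $\overline{F}_i^{DC_{\mathrm{RC}}}=\frac{\lambda_s}{n\lambda_e}\big[1-\big(\frac{\lambda_s}{\lambda_s+\lambda_e}\big)^n\big]$.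 *)

theory Defs
  imports "HOL-Probability.Probability"
begin

text \<open>
  Continuous-time Markov chains on a finite state space \<open>E\<close>, specified by off-diagonal
  jump rates \<open>q\<close>; the diagonal values of \<open>q\<close> are ignored.
\<close>

definition generator :: "'s set \<Rightarrow> ('s \<Rightarrow> 's \<Rightarrow> real) \<Rightarrow> 's \<Rightarrow> 's \<Rightarrow> real" where
  "generator E q x y = (if x = y then - (\<Sum>z\<in>E - {x}. q x z) else q x y)"

definition transition_function :: "'s set \<Rightarrow> (real \<Rightarrow> 's \<Rightarrow> 's \<Rightarrow> real) \<Rightarrow> bool" where
  "transition_function E P \<longleftrightarrow>
     (\<forall>t\<ge>0. \<forall>x\<in>E. \<forall>y\<in>E. 0 \<le> P t x y) \<and>
     (\<forall>t\<ge>0. \<forall>x\<in>E. (\<Sum>y\<in>E. P t x y) = 1) \<and>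
     (\<forall>x\<in>E. \<forall>y\<in>E. P 0 x y = (if x = y then 1 else 0)) \<and>
     (\<forall>s\<ge>0. \<forall>t\<ge>0. \<forall>x\<in>E. \<forall>z\<in>E. P (s + t) x z = (\<Sum>y\<in>E. P s x y * P t y z))"

text \<open>
  The last conjunct is the time-homogeneous Markov property, multiplied out so that no
  conditioning on null events occurs. Right-continuity is with respect to the discrete
  topology on states, i.e. a path stays in its current state for a positive time.
\<close>

definition finite_ctmc ::
  "'w measure \<Rightarrow> 's set \<Rightarrow> ('s \<Rightarrow> 's \<Rightarrow> real) \<Rightarrow> 's \<Rightarrow> (real \<Rightarrow> 'w \<Rightarrow> 's) \<Rightarrow> bool" where
  "finite_ctmc M E q x0 X \<longleftrightarrow>
     prob_space M \<and> finite E \<and>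
     (\<forall>t\<ge>0. X t \<in> measurable M (count_space E)) \<and>
     (AE \<omega> in M. X 0 \<omega> = x0) \<and>
     (\<forall>\<omega>\<in>space M. \<forall>t\<ge>0. \<forall>\<^sub>F s in at_right t. X s \<omega> = X t \<omega>) \<and>
     (\<exists>P. transition_function E P \<and>
        (\<forall>x\<in>E. \<forall>y\<in>E.
           ((\<lambda>t. P t x y) has_real_derivative generator E q x y) (at 0 within {0..})) \<and>
        (\<forall>t\<ge>0. \<forall>h\<ge>0. \<forall>J x. \<forall>y\<in>E. \<forall>z\<in>E. finite J \<longrightarrow> J \<subseteq> {0..t} \<longrightarrow>
           measure M {\<omega> \<in> space M. (\<forall>s\<in>J. X s \<omega> = x s) \<and> X t \<omega> = y \<and> X (t + h) \<omega> = z} =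
           measure M {\<omega> \<in> space M. (\<forall>s\<in>J. X s \<omega> = x s) \<and> X t \<omega> = y} * P h y z))"

text \<open>
  Jump rates of the set of fresh nodes: reset to the empty set at rate \<open>lam_e\<close>, and each stale
  node becomes fresh at a rate \<open>r k\<close> depending on the current number \<open>k\<close> of fresh nodes.
\<close>

definition fresh_set_rate :: "nat \<Rightarrow> real \<Rightarrow> (nat \<Rightarrow> real) \<Rightarrow> nat set \<Rightarrow> nat set \<Rightarrow> real" where
  "fresh_set_rate n lam_e r S S' =
     (if S' = {} then lam_e else 0) +
     (\<Sum>i\<in>{1..n} - S. if S' = insert i S then r (card S) else 0)"

definition DC_noRC ::
  "nat \<Rightarrow> real \<Rightarrow> real \<Rightarrow> 'w measure \<Rightarrow> (real \<Rightarrow> 'w \<Rightarrow> nat set) \<Rightarrow> bool" where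
  "DC_noRC n lam_s lam_e M X \<longleftrightarrow>
     finite_ctmc M (Pow {1..n}) (fresh_set_rate n lam_e (\<lambda>k. lam_s / real n)) {} X"

definition DC_RC ::
  "nat \<Rightarrow> real \<Rightarrow> real \<Rightarrow> 'w measure \<Rightarrow> (real \<Rightarrow> 'w \<Rightarrow> nat set) \<Rightarrow> bool" where
  "DC_RC n lam_s lam_e M X \<longleftrightarrow>
     finite_ctmc M (Pow {1..n}) (fresh_set_rate n lam_e (\<lambda>k. lam_s / (real n - real k))) {} X"

definition freshness :: "(real \<Rightarrow> 'w \<Rightarrow> nat set) \<Rightarrow> nat \<Rightarrow> real \<Rightarrow> 'w \<Rightarrow> real" where
  "freshness X i t \<omega> = (if i \<in> X t \<omega> then 1 else 0)"

definition avg_freshness :: "'w measure \<Rightarrow> (real \<Rightarrow> 'w \<Rightarrow> nat set) \<Rightarrow> nat \<Rightarrow> ereal" where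
  "avg_freshness M X i =
     Limsup at_top (\<lambda>T. ereal (1 / T *
       prob_space.expectation M (\<lambda>\<omega>. LINT t:{0..T}|lborel. freshness X i t \<omega>)))"

end

(* For each scheme a function g on the states solves the Poisson equation
     Q g = (indicator that node i is fresh) - c,
   so integrating the forward equation of E g(S(t)) over [0, T] and dividing by T shows, g being
   bounded, that the time average of the freshness converges to c. Here g is the expected time
   until node i becomes fresh or the source updates; it vanishes where i is fresh and depends only
   on the number of fresh nodes elsewhere. This yields both closed forms, and their comparison
   is the strict Bernoulli inequality for (1 + lam_e / lam_s) ^ n. *)

theory Submission
  imports Defs
begin

section \<open>The inequality between the two closed forms\<close>

lemma Bernoulli_inequality_strict:
  fixes x :: real
  assumes "x > 0" and "n \<ge> 2"
  shows "1 + real n * x < (1 + x) ^ n"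
  using assms(2)
proof (induction n rule: dec_induct)
  case base
  then show ?case using assms(1) by (simp add: power2_eq_square algebra_simps)
next
  case (step n)
  have "1 + real (Suc n) * x \<le> (1 + x) * (1 + real n * x)"
    using assms(1) by (simp add: algebra_simps)
  also have "\<dots> < (1 + x) * (1 + x) ^ n"
    using step assms(1) by (intro mult_strict_left_mono) auto
  finally show ?case by simp
qed

text \<open>Put \<open>v = s / (s + real n * e)\<close>. Bernoulli with \<open>e / s\<close>, after
  inversion, says that the power is smaller than \<open>v\<close>. Replacing the power by
  \<open>v\<close> on the right-hand side therefore lowers it, and the value obtained is exactly
  \<open>v\<close>.\<close>

lemma rate_changing_gt_traditional:
  fixes s e :: real
  assumes "n \<ge> 2" and "s > 0" and "e > 0"
  shows "s / (s + real n * e) < s / (real n * e) * (1 - (s / (s + e)) ^ n)"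
proof -
  have pos: "s + real n * e > 0" "real n * e > 0"
    using assms by (auto intro!: add_pos_pos)
  have "1 + real n * (e / s) < (1 + e / s) ^ n"
    using assms by (intro Bernoulli_inequality_strict) auto
  moreover have "1 + real n * (e / s) = (s + real n * e) / s" "1 + e / s = (s + e) / s"
    using assms by (auto simp: field_simps)
  ultimately have "(s + real n * e) / s < ((s + e) / s) ^ n"
    by simp
  then have "inverse (((s + e) / s) ^ n) < inverse ((s + real n * e) / s)"
    using pos(1) \<open>s > 0\<close> by (intro less_imp_inverse_less divide_pos_pos)
  then have "(s / (s + e)) ^ n < s / (s + real n * e)"
    by (simp add: power_divide)
  then have "s / (real n * e) * (1 - s / (s + real n * e))
      < s / (real n * e) * (1 - (s / (s + e)) ^ n)"
    using pos assms by (intro mult_strict_left_mono) auto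
  moreover have "s / (real n * e) * (1 - s / (s + real n * e)) = s / (s + real n * e)"
    using pos(1)[THEN less_imp_neq] assms by (simp add: divide_simps)
  ultimately show ?thesis by simp
qed

section \<open>The generator acting on functions of the state\<close>

text \<open>Rows of a generator sum to zero, so its action can be written through increments of
  \<open>g\<close>. Increments make the diagonal of \<open>q\<close> harmless; this matters for
  \<open>fresh_set_rate\<close>, whose value from the empty set to itself is the reset rate.\<close>

lemma sum_generator:
  assumes "finite E" and "x \<in> E"
  shows "(\<Sum>y\<in>E. generator E q x y * g y) = (\<Sum>y\<in>E. q x y * (g y - g x))"
proof -
  have "(\<Sum>y\<in>E. generator E q x y * g y)
      = generator E q x x * g x + (\<Sum>y\<in>E - {x}. generator E q x y * g y)"
    using assms by (rule sum.remove)
  also have "(\<Sum>y\<in>E - {x}. generator E q x y * g y) = (\<Sum>y\<in>E - {x}. q x y * g y)"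
    by (intro sum.cong) (auto simp: generator_def)
  also have "generator E q x x * g x + \<dots> = (\<Sum>y\<in>E - {x}. q x y * (g y - g x))"
    by (simp add: generator_def sum_subtractf sum_distrib_right right_diff_distrib)
  also have "\<dots> = (\<Sum>y\<in>E. q x y * (g y - g x))"
    using assms by (simp add: sum.remove)
  finally show ?thesis .
qed

text \<open>Turns a sum over all target sets into one over the possible moves: the reset and the
  insertion of each stale node. It is meant for \<open>h\<close> an increment of a test function, as
  produced by \<open>sum_generator\<close>.\<close>

lemma sum_fresh_set_rate:
  assumes "S \<subseteq> {1..n}"
  shows "(\<Sum>S'\<in>Pow {1..n}. fresh_set_rate n e r S S' * h S')
    = e * h {} + r (card S) * (\<Sum>j\<in>{1..n} - S. h (insert j S))"
proof -
  have "(\<Sum>S'\<in>Pow {1..n}. fresh_set_rate n e r S S' * h S')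
    = (\<Sum>S'\<in>Pow {1..n}. if S' = {} then e * h {} else 0)
    + (\<Sum>S'\<in>Pow {1..n}. \<Sum>j\<in>{1..n} - S.
        if S' = insert j S then r (card S) * h (insert j S) else 0)"
    unfolding fresh_set_rate_def distrib_right sum.distrib sum_distrib_right
    by (intro arg_cong2[of _ _ _ _ "(+)"] sum.cong) auto
  also have "(\<Sum>S'\<in>Pow {1..n}. if S' = {} then e * h {} else 0) = e * h {}"
    by (subst sum.delta) auto
  also have "(\<Sum>S'\<in>Pow {1..n}. \<Sum>j\<in>{1..n} - S.
        if S' = insert j S then r (card S) * h (insert j S) else 0)
      = (\<Sum>j\<in>{1..n} - S. r (card S) * h (insert j S))"
    using assms by (subst sum.swap, intro sum.cong) auto
  finally show ?thesis by (simp add: sum_distrib_left)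
qed

section \<open>Continuity and forward equation of a finite transition function\<close>

lemma transition_function_le_1:
  assumes "finite E" and "transition_function E P" and "t \<ge> 0" and "x \<in> E" and "y \<in> E"
  shows "P t x y \<le> 1"
  using member_le_sum[of y E "P t x"] assms by (auto simp: transition_function_def)

text \<open>Differentiability at 0 gives continuity at 0, and the semigroup law carries it to every
  time: the increment from \<open>s\<close> to \<open>s + h\<close> is row \<open>x\<close> of
  \<open>P s\<close> applied to \<open>P h\<close> minus the identity. The entries of
  \<open>P s\<close> are at most 1, so the bound \<open>m h\<close> is uniform in
  \<open>s\<close>.\<close>

lemma transition_function_continuous:
  assumes "finite E" and P: "transition_function E P"
    and deriv: "\<And>x y. x \<in> E \<Longrightarrow> y \<in> E \<Longrightarrow>
      ((\<lambda>t. P t x y) has_real_derivative generator E q x y) (at 0 within {0..})"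
    and "x \<in> E" and "z \<in> E" and "t \<ge> 0"
  shows "((\<lambda>s. P s x z) \<longlongrightarrow> P t x z) (at t within {0..})"
proof -
  let ?\<delta> = "\<lambda>y z. if y = z then 1 else 0 :: real"
  have nonneg: "\<And>t x y. t \<ge> 0 \<Longrightarrow> x \<in> E \<Longrightarrow> y \<in> E \<Longrightarrow> 0 \<le> P t x y"
    and zero: "\<And>x y. x \<in> E \<Longrightarrow> y \<in> E \<Longrightarrow> P 0 x y = ?\<delta> x y"
    and semi: "\<And>s t x z. s \<ge> 0 \<Longrightarrow> t \<ge> 0 \<Longrightarrow> x \<in> E \<Longrightarrow> z \<in> E \<Longrightarrow>
      P (s + t) x z = (\<Sum>y\<in>E. P s x y * P t y z)"
    using P unfolding transition_function_def by auto
  define m where "m h = (\<Sum>y\<in>E. \<bar>P h y z - ?\<delta> y z\<bar>)" for h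
  have bound: "\<bar>P (s + h) x z - P s x z\<bar> \<le> m h" if "s \<ge> 0" "h \<ge> 0" for s h
  proof -
    have "P s x z = (\<Sum>y\<in>E. P s x y * ?\<delta> y z)"
      using assms by (simp add: if_distrib sum.delta cong: if_cong)
    then have "P (s + h) x z - P s x z = (\<Sum>y\<in>E. P s x y * (P h y z - ?\<delta> y z))"
      using semi[OF that \<open>x \<in> E\<close> \<open>z \<in> E\<close>]
      by (simp add: right_diff_distrib sum_subtractf)
    also have "\<bar>\<dots>\<bar> \<le> (\<Sum>y\<in>E. \<bar>P s x y * (P h y z - ?\<delta> y z)\<bar>)"
      by (rule sum_abs)
    also have "\<dots> \<le> m h"
      unfolding m_def
    proof (intro sum_mono)
      fix y assume y: "y \<in> E"
      have "P s x y \<le> 1"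
        using assms that y by (intro transition_function_le_1[OF _ P])
      then show "\<bar>P s x y * (P h y z - ?\<delta> y z)\<bar> \<le> \<bar>P h y z - ?\<delta> y z\<bar>"
        using nonneg[OF that(1) \<open>x \<in> E\<close> y] by (simp only: abs_mult mult_left_le_one_le abs_ge_zero abs_of_nonneg)
    qed
    finally show ?thesis .
  qed
  have "(m \<longlongrightarrow> (\<Sum>y\<in>E. \<bar>?\<delta> y z - ?\<delta> y z\<bar>)) (at 0 within {0..})"
    unfolding m_def
  proof (intro tendsto_sum tendsto_rabs tendsto_diff tendsto_const)
    fix y assume y: "y \<in> E"
    have "continuous (at 0 within {0..}) (\<lambda>h. P h y z)"
      using deriv[OF y \<open>z \<in> E\<close>] by (rule DERIV_continuous)
    then show "((\<lambda>h. P h y z) \<longlongrightarrow> ?\<delta> y z) (at 0 within {0..})"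
      using zero[OF y \<open>z \<in> E\<close>] by (simp add: continuous_within)
  qed
  moreover have "filterlim (\<lambda>s. \<bar>s - t\<bar>) (at 0 within {0..}) (at t within {0..})"
    unfolding filterlim_at
    by (auto intro!: tendsto_eq_intros simp: eventually_at_filter)
  ultimately have "((\<lambda>s. m \<bar>s - t\<bar>) \<longlongrightarrow> 0) (at t within {0..})"
    by (auto intro: filterlim_compose)
  moreover have "\<bar>P s x z - P t x z\<bar> \<le> m \<bar>s - t\<bar>" if "s \<ge> 0" for s
    using bound[of s "t - s"] bound[of t "s - t"] that \<open>t \<ge> 0\<close>
    by (cases "s \<le> t") (auto simp: abs_minus_commute)
  then have "\<forall>\<^sub>F s in at t within {0..}. norm (P s x z - P t x z) \<le> m \<bar>s - t\<bar>"
    by (auto simp: eventually_at_filter)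
  ultimately have "((\<lambda>s. P s x z - P t x z) \<longlongrightarrow> 0) (at t within {0..})"
    by (rule Lim_null_comparison[rotated])
  then show ?thesis by (simp add: LIM_zero_iff)
qed

text \<open>By the semigroup law a difference quotient at time \<open>t\<close> is a row of
  \<open>P\<close> applied to the quotient \<open>D\<close> at time 0, whose limit is the generator
  acting on \<open>g\<close>. Continuity of \<open>P\<close> lets both factors pass to the
  limit.\<close>

lemma transition_function_forward_equation:
  assumes "finite E" and P: "transition_function E P"
    and deriv: "\<And>x y. x \<in> E \<Longrightarrow> y \<in> E \<Longrightarrow>
      ((\<lambda>t. P t x y) has_real_derivative generator E q x y) (at 0 within {0..})"
    and "x \<in> E" and "t \<ge> 0"
  shows "((\<lambda>t. \<Sum>z\<in>E. P t x z * g z) has_real_derivative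
    (\<Sum>y\<in>E. P t x y * (\<Sum>z\<in>E. generator E q y z * g z))) (at t within {0..})"
proof -
  have zero: "\<And>x y. x \<in> E \<Longrightarrow> y \<in> E \<Longrightarrow> P 0 x y = (if x = y then 1 else 0)"
    and semi: "\<And>s t x z. s \<ge> 0 \<Longrightarrow> t \<ge> 0 \<Longrightarrow> x \<in> E \<Longrightarrow> z \<in> E \<Longrightarrow>
      P (s + t) x z = (\<Sum>y\<in>E. P s x y * P t y z)"
    using P unfolding transition_function_def by auto
  define U where "U t y = (\<Sum>z\<in>E. P t y z * g z)" for t y
  define D where "D h y = (U h y - g y) / h" for h y
  have U_add: "U (s + h) x - U s x = h * (\<Sum>y\<in>E. P s x y * D h y)"
    if "s \<ge> 0" "h > 0" for s h
  proof -
    have "U (s + h) x = (\<Sum>z\<in>E. \<Sum>y\<in>E. P s x y * P h y z * g z)"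
      unfolding U_def using that \<open>x \<in> E\<close> by (simp add: semi sum_distrib_right)
    also have "\<dots> = (\<Sum>y\<in>E. P s x y * U h y)"
      unfolding U_def by (subst sum.swap) (simp add: sum_distrib_left mult.assoc)
    finally have "U (s + h) x - U s x = (\<Sum>y\<in>E. P s x y * (U h y - g y))"
      by (simp add: U_def right_diff_distrib sum_subtractf)
    then show ?thesis
      using that by (simp add: D_def sum_distrib_left)
  qed
  \<comment> \<open>The step always starts at the earlier of the two times, hence
    \<open>min s t\<close>; this treats left and right quotients by one formula.\<close>
  have "(U s x - U t x) / (s - t) = (\<Sum>y\<in>E. P (min s t) x y * D \<bar>s - t\<bar> y)"
    if "s \<ge> 0" "s \<noteq> t" for s
  proof (cases "s < t")
    case True
    then show ?thesis
      using U_add[of s "t - s"] that by (simp add: divide_simps algebra_simps)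
  next
    case False
    then show ?thesis
      using U_add[of t "s - t"] that \<open>t \<ge> 0\<close> by (simp add: divide_simps algebra_simps)
  qed
  then have ev: "\<forall>\<^sub>F s in at t within {0..}.
      (\<Sum>y\<in>E. P (min s t) x y * D \<bar>s - t\<bar> y) = (U s x - U t x) / (s - t)"
    by (auto simp: eventually_at_filter)
  have abs_lim: "filterlim (\<lambda>s. \<bar>s - t\<bar>) (at 0 within {0..}) (at t within {0..})"
    unfolding filterlim_at
    by (auto intro!: tendsto_eq_intros simp: eventually_at_filter)
  have "((\<lambda>s. \<Sum>y\<in>E. P (min s t) x y * D \<bar>s - t\<bar> y) \<longlongrightarrow>
      (\<Sum>y\<in>E. P t x y * (\<Sum>z\<in>E. generator E q y z * g z))) (at t within {0..})"
  proof (intro tendsto_sum tendsto_mult)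
    fix y assume y: "y \<in> E"
    have cont: "continuous_on {0..} (\<lambda>s. P s x y)"
      unfolding continuous_on_def
      using transition_function_continuous[OF \<open>finite E\<close> P deriv \<open>x \<in> E\<close> y] by auto
    have "continuous_on {0..} (\<lambda>s. P (min s t) x y)"
      using \<open>t \<ge> 0\<close> by (intro continuous_on_compose2[OF cont] continuous_intros) auto
    then show "((\<lambda>s. P (min s t) x y) \<longlongrightarrow> P t x y) (at t within {0..})"
      using \<open>t \<ge> 0\<close> unfolding continuous_on_def by force
    have "((\<lambda>h. U h y) has_real_derivative (\<Sum>z\<in>E. generator E q y z * g z))
        (at 0 within {0..})"
      unfolding U_def using y
      by (intro DERIV_sum DERIV_cmult_right deriv) auto
    moreover have "U 0 y = g y"
      using y \<open>finite E\<close> by (simp add: U_def zero if_distrib[of "\<lambda>c. c * _"] cong: if_cong)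
    ultimately have "((\<lambda>h. D h y) \<longlongrightarrow> (\<Sum>z\<in>E. generator E q y z * g z)) (at 0 within {0..})"
      by (simp add: has_field_derivative_iff D_def)
    then show "((\<lambda>s. D \<bar>s - t\<bar> y) \<longlongrightarrow> (\<Sum>z\<in>E. generator E q y z * g z)) (at t within {0..})"
      using abs_lim by (rule filterlim_compose)
  qed
  then have "((\<lambda>s. (U s x - U t x) / (s - t)) \<longlongrightarrow>
      (\<Sum>y\<in>E. P t x y * (\<Sum>z\<in>E. generator E q y z * g z))) (at t within {0..})"
    using ev by (rule Lim_transform_eventually)
  then show ?thesis
    by (simp add: has_field_derivative_iff U_def)
qed

section \<open>Exchange of expectation and time integral\<close>

text \<open>Fubini needs joint measurability in outcome and time. Right-continuity supplies it: the
  process is the pointwise limit of copies sampled at grid times to the right of \<open>t\<close>,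
  and each copy involves only countably many random variables.\<close>

lemma (in prob_space) expectation_set_integral_right_continuous:
  fixes Y :: "real \<Rightarrow> 'a \<Rightarrow> real"
  assumes meas: "\<And>t. t \<ge> 0 \<Longrightarrow> Y t \<in> borel_measurable M"
    and rc: "\<And>t \<omega>. t \<ge> 0 \<Longrightarrow> \<omega> \<in> space M \<Longrightarrow> ((\<lambda>s. Y s \<omega>) \<longlongrightarrow> Y t \<omega>) (at_right t)"
    and bound: "\<And>t \<omega>. t \<ge> 0 \<Longrightarrow> \<omega> \<in> space M \<Longrightarrow> \<bar>Y t \<omega>\<bar> \<le> B"
  shows "expectation (\<lambda>\<omega>. LINT t:{0..T}|lborel. Y t \<omega>)
    = (LINT t:{0..T}|lborel. expectation (Y t))"
proof -
  interpret pair_sigma_finite M lborel ..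
  \<comment> \<open>The first point of the grid of mesh \<open>1 / real (Suc k)\<close> strictly
    after \<open>t\<close>. Adding 1 to the floor, instead of taking a ceiling, keeps it different
    from \<open>t\<close>, as a limit along \<open>at_right t\<close> requires.\<close>
  define a where "a k t = (of_int (\<lfloor>real (Suc k) * t\<rfloor> + 1) / real (Suc k) :: real)" for k t
  have a_gt: "a k t > t" for k t
    unfolding a_def by (simp add: field_simps del: of_nat_Suc) linarith
  have a_le: "a k t \<le> t + 1 / real (Suc k)" for k t
    unfolding a_def by (simp add: field_simps del: of_nat_Suc)
  have a_lim: "filterlim (\<lambda>k. a k t) (at_right t) sequentially" for t
    unfolding filterlim_at
  proof
    have "(\<lambda>k. a k t) \<longlonglongrightarrow> t"
    proof (rule tendsto_sandwich)
      show "\<forall>\<^sub>F k in sequentially. t \<le> a k t" by (simp add: a_gt less_imp_le)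
      show "\<forall>\<^sub>F k in sequentially. a k t \<le> t + 1 / real (Suc k)" using a_le by (intro always_eventually) blast
      show "(\<lambda>k. t + 1 / real (Suc k)) \<longlonglongrightarrow> t"
        using tendsto_add[OF tendsto_const LIMSEQ_Suc[OF lim_1_over_n], of t] by simp
    qed simp
    then show "(\<lambda>k. a k t) \<longlonglongrightarrow> t" .
    show "\<forall>\<^sub>F k in sequentially. a k t \<in> {t<..} \<and> a k t \<noteq> t"
      using a_gt less_imp_neq[OF a_gt, THEN not_sym] by (intro always_eventually) blast
  qed
  define Z where "Z = (\<lambda>(\<omega>, t). indicator {0..T} t * Y t \<omega>)"
  have "Z \<in> borel_measurable (M \<Otimes>\<^sub>M lborel)"
  proof (rule borel_measurable_LIMSEQ_real)
    fix k
    \<comment> \<open>Measurability is assumed at nonnegative times only, so negative grid indices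
      get the value 0; the indicator of \<open>{0..T}\<close> hides this choice.\<close>
    define y where "y j \<omega> = (if j \<ge> 0 then Y (of_int j / real (Suc k)) \<omega> else 0)" for j :: int and \<omega>
    have [measurable]: "y j \<in> borel_measurable M" for j
      unfolding y_def by (cases "j \<ge> 0") (auto intro!: meas)
    have "(\<lambda>p. y (\<lfloor>real (Suc k) * snd p\<rfloor> + 1) (fst p)) \<in> borel_measurable (M \<Otimes>\<^sub>M lborel)"
      by (rule measurable_compose_countable[where f = "\<lambda>j p. y j (fst p)"]) measurable
    then have "(\<lambda>p. indicator {0..T} (snd p) * y (\<lfloor>real (Suc k) * snd p\<rfloor> + 1) (fst p))
        \<in> borel_measurable (M \<Otimes>\<^sub>M lborel)"
      by measurable
    also have "(\<lambda>p. indicator {0..T} (snd p) * y (\<lfloor>real (Suc k) * snd p\<rfloor> + 1) (fst p))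
        = (\<lambda>p. indicator {0..T} (snd p) * Y (a k (snd p)) (fst p))"
      by (auto simp: y_def a_def fun_eq_iff indicator_def)
    finally show "(\<lambda>p. indicator {0..T} (snd p) * Y (a k (snd p)) (fst p))
        \<in> borel_measurable (M \<Otimes>\<^sub>M lborel)" .
  next
    fix p :: "'a \<times> real" assume "p \<in> space (M \<Otimes>\<^sub>M lborel)"
    then have p: "fst p \<in> space M"
      by (auto simp: space_pair_measure)
    show "(\<lambda>k. indicator {0..T} (snd p) * Y (a k (snd p)) (fst p)) \<longlonglongrightarrow> Z p"
    proof (cases "snd p \<in> {0..T}")
      case True
      then have "(\<lambda>k. Y (a k (snd p)) (fst p)) \<longlonglongrightarrow> Y (snd p) (fst p)"
        using rc[OF _ p] by (intro filterlim_compose[OF _ a_lim]) auto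
      then show ?thesis
        using True by (simp add: Z_def case_prod_beta)
    qed (simp add: Z_def case_prod_beta)
  qed
  moreover have "emeasure (M \<Otimes>\<^sub>M lborel) (space M \<times> {0..T}) < \<infinity>"
    by (subst lborel.emeasure_pair_measure_Times) (auto simp: emeasure_space_1 emeasure_lborel_Icc_eq)
  ultimately have "integrable (M \<Otimes>\<^sub>M lborel) Z"
    using bound
    by (intro integrableI_bounded_set[where A = "space M \<times> {0..T}" and B = B] AE_I2)
      (auto simp: Z_def space_pair_measure indicator_def split: if_splits)
  then have "(\<integral>\<omega>. \<integral>t. indicator {0..T} t * Y t \<omega> \<partial>lborel \<partial>M)
      = (\<integral>t. \<integral>\<omega>. indicator {0..T} t * Y t \<omega> \<partial>M \<partial>lborel)"
    unfolding Z_def by (rule Fubini_integral[symmetric])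
  then show ?thesis
    by (simp add: set_lebesgue_integral_def)
qed

section \<open>One-dimensional marginals of the chain\<close>

text \<open>The Markov property at time 0, with no earlier times to condition on, gives the law at
  time \<open>t\<close>, because the initial state is almost surely \<open>x0\<close>.\<close>

lemma finite_ctmc_marginal:
  assumes X: "finite_ctmc M E q x0 X" and "x0 \<in> E"
  obtains P where "transition_function E P"
    and "\<And>x y. x \<in> E \<Longrightarrow> y \<in> E \<Longrightarrow>
      ((\<lambda>t. P t x y) has_real_derivative generator E q x y) (at 0 within {0..})"
    and "\<And>t y. t \<ge> 0 \<Longrightarrow> y \<in> E \<Longrightarrow> measure M {\<omega> \<in> space M. X t \<omega> = y} = P t x0 y"
proof -
  interpret prob_space M
    using X by (simp add: finite_ctmc_def)
  have meas: "\<And>t. t \<ge> 0 \<Longrightarrow> X t \<in> measurable M (count_space E)"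
    and init: "AE \<omega> in M. X 0 \<omega> = x0"
    using X by (auto simp: finite_ctmc_def)
  obtain P where P: "transition_function E P"
    "\<forall>x\<in>E. \<forall>y\<in>E.
      ((\<lambda>t. P t x y) has_real_derivative generator E q x y) (at 0 within {0..})"
    and markov: "\<forall>t\<ge>0. \<forall>h\<ge>0. \<forall>J x. \<forall>y\<in>E. \<forall>z\<in>E. finite J \<longrightarrow> J \<subseteq> {0..t} \<longrightarrow>
       measure M {\<omega> \<in> space M. (\<forall>s\<in>J. X s \<omega> = x s) \<and> X t \<omega> = y \<and> X (t + h) \<omega> = z} =
       measure M {\<omega> \<in> space M. (\<forall>s\<in>J. X s \<omega> = x s) \<and> X t \<omega> = y} * P h y z"
    using X unfolding finite_ctmc_def by (elim conjE exE) (rule that)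
  have "measure M {\<omega> \<in> space M. X t \<omega> = y} = P t x0 y" if t: "t \<ge> 0" and y: "y \<in> E" for t y
  proof -
    note [measurable] = meas[OF t] meas[OF order_refl]
    have ev: "{\<omega> \<in> space M. X t \<omega> = y} \<in> events" "{\<omega> \<in> space M. X 0 \<omega> = x0} \<in> events"
      using y \<open>x0 \<in> E\<close> by measurable
    then have ev': "{\<omega> \<in> space M. X 0 \<omega> = x0 \<and> X t \<omega> = y} \<in> events"
      by (auto intro: sets.sets_Collect_conj)
    have "measure M {\<omega> \<in> space M. X 0 \<omega> = x0 \<and> X (0 + t) \<omega> = y}
        = measure M {\<omega> \<in> space M. X 0 \<omega> = x0} * P t x0 y"
      using markov[rule_format, of 0 t x0 y "{}"] t y \<open>x0 \<in> E\<close> by simp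
    moreover have "measure M {\<omega> \<in> space M. X 0 \<omega> = x0} = 1"
      using init ev by (simp add: prob_Collect_eq_1)
    moreover have "measure M {\<omega> \<in> space M. X 0 \<omega> = x0 \<and> X t \<omega> = y}
        = measure M {\<omega> \<in> space M. X t \<omega> = y}"
      using init ev ev' by (intro finite_measure_eq_AE) auto
    ultimately show ?thesis by simp
  qed
  with P show ?thesis by (intro that) auto
qed

section \<open>Long-term freshness for general filling rates\<close>

text \<open>
  The hypothesis on \<open>w\<close> is the first-step equation for the expected time until the node becomes
  fresh or the source updates, starting from a state with \<open>k\<close> fresh nodes in which the node is stale.
\<close>

lemma avg_freshness_fresh_set:
  assumes X: "finite_ctmc M (Pow {1..n}) (fresh_set_rate n e r) {} X" and i: "i \<in> {1..n}"
    and w: "\<And>k. k < n \<Longrightarrow>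
      (e + real (n - k) * r k) * w k = 1 + real (n - k - 1) * r k * w (Suc k)"
  shows "avg_freshness M X i = ereal (1 - e * w 0)"
proof -
  interpret prob_space M
    using X by (simp add: finite_ctmc_def)
  let ?E = "Pow {1..n}"
  let ?q = "fresh_set_rate n e r"
  have meas: "\<And>t. t \<ge> 0 \<Longrightarrow> X t \<in> measurable M (count_space ?E)"
    and rc: "\<And>\<omega> t. \<omega> \<in> space M \<Longrightarrow> t \<ge> 0 \<Longrightarrow> \<forall>\<^sub>F s in at_right t. X s \<omega> = X t \<omega>"
    using X by (auto simp: finite_ctmc_def)
  obtain P where P: "transition_function ?E P"
    and deriv: "\<And>x y. x \<in> ?E \<Longrightarrow> y \<in> ?E \<Longrightarrow>
      ((\<lambda>t. P t x y) has_real_derivative generator ?E ?q x y) (at 0 within {0..})"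
    and marginal: "\<And>t y. t \<ge> 0 \<Longrightarrow> y \<in> ?E \<Longrightarrow> prob {\<omega> \<in> space M. X t \<omega> = y} = P t {} y"
    using finite_ctmc_marginal[OF X] by auto
  have nonneg: "\<And>t y. t \<ge> 0 \<Longrightarrow> y \<in> ?E \<Longrightarrow> 0 \<le> P t {} y"
    and total: "\<And>t. t \<ge> 0 \<Longrightarrow> (\<Sum>y\<in>?E. P t {} y) = 1"
    using P unfolding transition_function_def by auto
  define f :: "nat set \<Rightarrow> real" where "f S = (if i \<in> S then 1 else 0)" for S
  define p where "p t = (\<Sum>S\<in>?E. P t {} S * f S)" for t
  define g where "g S = (if i \<in> S then 0 else w (card S))" for S
  have poisson: "(\<Sum>S'\<in>?E. generator ?E ?q S S' * g S') = f S - (1 - e * w 0)"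
    if S: "S \<in> ?E" for S
  proof -
    have fin: "finite S" using S finite_subset by auto
    have "(\<Sum>S'\<in>?E. generator ?E ?q S S' * g S')
        = e * (w 0 - g S) + r (card S) * (\<Sum>j\<in>{1..n} - S. g (insert j S) - g S)"
      using S unfolding sum_generator[OF finite_Pow_iff[THEN iffD2, OF finite_atLeastAtMost] S]
      by (subst sum_fresh_set_rate) (auto simp: g_def)
    also have "\<dots> = f S - (1 - e * w 0)"
    \<comment> \<open>If \<open>i\<close> is fresh, insertions leave \<open>g\<close> at 0 and only
      the reset, which leads to the value \<open>w 0\<close>, contributes.\<close>
    proof (cases "i \<in> S")
      case True
      then show ?thesis by (simp add: g_def f_def)
    next
      case False
      let ?k = "card S"
      have card: "card ({1..n} - S) = n - ?k"
        using S fin by (subst card_Diff_subset) auto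
      have "?k < n"
        using False i S by (metis PowD card_atLeastAtMost diff_Suc_1 finite_atLeastAtMost psubsetI psubset_card_mono)
      \<comment> \<open>Inserting \<open>i\<close> itself sends \<open>g\<close> to 0, while each of
        the other \<open>n - ?k - 1\<close> stale nodes leads to \<open>w (Suc ?k)\<close>. This
        split is what the hypothesis on \<open>w\<close> matches.\<close>
      have "(\<Sum>j\<in>{1..n} - S. g (insert j S) - g S)
          = (g (insert i S) - g S) + (\<Sum>j\<in>{1..n} - S - {i}. g (insert j S) - g S)"
        using False i by (intro sum.remove) auto
      also have "(\<Sum>j\<in>{1..n} - S - {i}. g (insert j S) - g S)
          = (\<Sum>j\<in>{1..n} - S - {i}. w (Suc ?k) - w ?k)"
        using False fin by (intro sum.cong) (auto simp: g_def)
      also have "\<dots> = real (n - ?k - 1) * (w (Suc ?k) - w ?k)"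
        using False i card by simp
      finally have "e * (w 0 - g S) + r ?k * (\<Sum>j\<in>{1..n} - S. g (insert j S) - g S)
          = e * (w 0 - w ?k) + r ?k * (real (n - ?k - 1) * (w (Suc ?k) - w ?k) - w ?k)"
        using False by (simp add: g_def)
      moreover have "real (n - ?k) = real (n - ?k - 1) + 1"
        using \<open>?k < n\<close> by simp
      ultimately show ?thesis
        using w[OF \<open>?k < n\<close>] False by (simp add: f_def algebra_simps)
    qed
    finally show ?thesis .
  qed
  define G where "G t = (\<Sum>S\<in>?E. P t {} S * g S)" for t
  have G_deriv: "(G has_real_derivative p t - (1 - e * w 0)) (at t within {0..})"
    if "t \<ge> 0" for t
  proof -
    have "(G has_real_derivative (\<Sum>S\<in>?E. P t {} S * (\<Sum>S'\<in>?E. generator ?E ?q S S' * g S')))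
        (at t within {0..})"
      unfolding G_def using deriv that
      by (intro transition_function_forward_equation[OF _ P]) auto
    also have "(\<Sum>S\<in>?E. P t {} S * (\<Sum>S'\<in>?E. generator ?E ?q S S' * g S'))
        = (\<Sum>S\<in>?E. P t {} S * (f S - (1 - e * w 0)))"
      by (intro sum.cong refl arg_cong2[of _ _ _ _ "(*)"] poisson)
    also have "\<dots> = p t - (1 - e * w 0)"
      unfolding p_def right_diff_distrib[of _ _ "1 - e * w 0"] sum_subtractf
      unfolding sum_distrib_right[symmetric] using total[OF that] by simp
    finally show ?thesis .
  qed
  have G_bound: "\<bar>G t\<bar> \<le> (\<Sum>S\<in>?E. \<bar>g S\<bar>)" if "t \<ge> 0" for t
  proof -
    have "P t {} S \<le> 1" if "S \<in> ?E" for S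
      using that \<open>t \<ge> 0\<close> by (intro transition_function_le_1[OF _ P]) auto
    then show ?thesis
      unfolding G_def using nonneg[OF that]
      by (intro order_trans[OF sum_abs] sum_mono)
        (simp del: Pow_iff add: abs_mult mult_left_le_one_le)
  qed
  have expect: "expectation (freshness X i t) = p t" if t: "t \<ge> 0" for t
  proof -
    note [measurable] = meas[OF t]
    have "expectation (freshness X i t)
        = expectation (\<lambda>\<omega>. \<Sum>S\<in>?E. f S * indicator {\<omega> \<in> space M. X t \<omega> = S} \<omega>)"
    proof (intro Bochner_Integration.integral_cong refl)
      fix \<omega> assume "\<omega> \<in> space M"
      then have "X t \<omega> \<in> ?E"
        using measurable_space[OF meas[OF t]] by simp
      then show "freshness X i t \<omega> = (\<Sum>S\<in>?E. f S * indicator {\<omega> \<in> space M. X t \<omega> = S} \<omega>)"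
        using \<open>\<omega> \<in> space M\<close>
        by (simp add: indicator_def freshness_def f_def if_distrib[of "\<lambda>c. _ * c"] sum.delta' del: Pow_iff cong: if_cong)
    qed
    also have "\<dots> = (\<Sum>S\<in>?E. f S * prob {\<omega> \<in> space M. X t \<omega> = S})"
    proof (subst Bochner_Integration.integral_sum)
      fix S assume "S \<in> ?E"
      then have "{\<omega> \<in> space M. X t \<omega> = S} \<in> events"
        by measurable
      then show "integrable M (\<lambda>\<omega>. f S * indicator {\<omega> \<in> space M. X t \<omega> = S} \<omega>)"
        by (intro integrable_mult_right integrable_real_indicator) (auto simp: emeasure_eq_measure)
    qed (simp add: Int_absorb1)
    also have "\<dots> = p t"
      unfolding p_def by (intro sum.cong refl) (simp add: marginal[OF t] mult.commute del: Pow_iff)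
    finally show ?thesis .
  qed
  have fubini: "expectation (\<lambda>\<omega>. LINT t:{0..T}|lborel. freshness X i t \<omega>)
      = (LINT t:{0..T}|lborel. p t)" for T
  proof -
    have "expectation (\<lambda>\<omega>. LINT t:{0..T}|lborel. freshness X i t \<omega>)
      = (LINT t:{0..T}|lborel. expectation (freshness X i t))"
    proof (rule expectation_set_integral_right_continuous[where B = 1])
      fix t :: real assume t: "t \<ge> 0"
      have "f \<circ> X t \<in> borel_measurable M"
        using meas[OF t] by (rule measurable_comp) simp
      then show "freshness X i t \<in> borel_measurable M"
        by (simp add: comp_def f_def freshness_def[abs_def])
    next
      fix t \<omega> assume "t \<ge> (0::real)" "\<omega> \<in> space M"
      then show "((\<lambda>s. freshness X i s \<omega>) \<longlongrightarrow> freshness X i t \<omega>) (at_right t)"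
        by (intro tendsto_eventually eventually_mono[OF rc]) (auto simp: freshness_def)
    qed (simp add: freshness_def)
    also have "\<dots> = (LINT t:{0..T}|lborel. p t)"
      by (intro set_lebesgue_integral_cong) (auto simp: expect)
    finally show ?thesis .
  qed
  have p_cont: "continuous_on {0..} p"
    unfolding p_def continuous_on_def
    using transition_function_continuous[OF _ P deriv] by (intro ballI tendsto_intros) auto
  have integral: "(LINT t:{0..T}|lborel. p t) = G T - G 0 + (1 - e * w 0) * T" if "T \<ge> 0" for T
  proof -
    \<comment> \<open>The forward equation makes \<open>G\<close> plus a linear term an
      antiderivative of \<open>p\<close>.\<close>
    have "(LINT t:{0..T}|lborel. p t) = (G T + (1 - e * w 0) * T) - (G 0 + (1 - e * w 0) * 0)"
      unfolding set_lebesgue_integral_def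
    proof (rule integral_FTC_atLeastAtMost[OF that])
      fix t assume t: "0 \<le> t" "t \<le> T"
      have "((\<lambda>t. G t + (1 - e * w 0) * t) has_real_derivative p t) (at t within {0..T})"
        by (rule derivative_eq_intros DERIV_subset[OF G_deriv] refl | use t in force)+
      then show "((\<lambda>t. G t + (1 - e * w 0) * t) has_vector_derivative p t) (at t within {0..T})"
        by (simp add: has_real_derivative_iff_has_vector_derivative)
    qed (use p_cont continuous_on_subset in force)
    then show ?thesis by simp
  qed
  \<comment> \<open>The boundary term is bounded uniformly in \<open>T\<close>, so it disappears
    from the time average.\<close>
  have "((\<lambda>T. (G T - G 0) / T) \<longlongrightarrow> 0) at_top"
  proof (rule Lim_null_comparison)
    let ?B = "2 * (\<Sum>S\<in>?E. \<bar>g S\<bar>)"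
    show "\<forall>\<^sub>F T in at_top. norm ((G T - G 0) / T) \<le> ?B / T"
      using eventually_gt_at_top[of 0]
    proof eventually_elim
      case (elim T)
      then have "\<bar>G T - G 0\<bar> \<le> ?B"
        using G_bound[of T] G_bound[of 0] by linarith
      then show ?case using elim by (simp add: divide_right_mono)
    qed
    show "((\<lambda>T. ?B / T) \<longlongrightarrow> 0) at_top"
      by (intro tendsto_divide_0[OF tendsto_const] filterlim_at_top_imp_at_infinity filterlim_ident)
  qed
  then have "((\<lambda>T. (G T - G 0) / T + (1 - e * w 0)) \<longlongrightarrow> 0 + (1 - e * w 0)) at_top"
    by (intro tendsto_add tendsto_const)
  moreover have "\<forall>\<^sub>F T in at_top. (G T - G 0) / T + (1 - e * w 0)
      = 1 / T * expectation (\<lambda>\<omega>. LINT t:{0..T}|lborel. freshness X i t \<omega>)"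
    using eventually_gt_at_top[of 0]
    by eventually_elim (simp add: fubini integral field_simps)
  ultimately have "((\<lambda>T. 1 / T * expectation (\<lambda>\<omega>. LINT t:{0..T}|lborel. freshness X i t \<omega>))
      \<longlongrightarrow> 1 - e * w 0) at_top"
    by (auto intro: Lim_transform_eventually)
  then show ?thesis
    unfolding avg_freshness_def by (intro lim_imp_Limsup) auto
qed

section \<open>The two schemes and their comparison\<close>

text \<open>A stale node competes only with the source update, at total rate
  \<open>e + s / real n\<close> whatever the other nodes do, so the expected waiting time is the
  constant inverse of that rate.\<close>

lemma avg_freshness_DC_noRC:
  assumes X: "DC_noRC n s e M X" and i: "i \<in> {1..n}" and "s > 0" and "e > 0"
  shows "avg_freshness M X i = ereal (s / (s + real n * e))"
proof -
  have n: "n > 0" using i by auto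
  have pos: "e + s / real n > 0" "s + real n * e > 0"
    using n assms by (auto intro!: add_pos_pos)
  have "avg_freshness M X i = ereal (1 - e * (1 / (e + s / real n)))"
  proof (rule avg_freshness_fresh_set[where w = "\<lambda>_. 1 / (e + s / real n)", OF X[unfolded DC_noRC_def] i])
    fix k assume "k < n"
    define m where "m = real (n - k - 1)"
    define c where "c = s / real n"
    have "real (n - k) = m + 1"
      using \<open>k < n\<close> by (simp add: m_def)
    then show "(e + real (n - k) * (s / real n)) * (1 / (e + s / real n))
        = 1 + real (n - k - 1) * (s / real n) * (1 / (e + s / real n))"
      unfolding m_def[symmetric] using pos(1) unfolding c_def[symmetric]
      by (simp add: field_simps)
  qed
  also have "1 - e * (1 / (e + s / real n)) = s / (s + real n * e)"
    using pos n by (simp add: divide_simps)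
  finally show ?thesis .
qed

text \<open>With \<open>m\<close> stale nodes left the total filling rate is always
  \<open>s\<close>. Multiplying the first-step equation by \<open>m\<close> therefore gives a linear
  recurrence with constant coefficients for \<open>x m\<close>, which is \<open>m\<close> times the
  expected waiting time.\<close>

lemma avg_freshness_DC_RC:
  assumes X: "DC_RC n s e M X" and i: "i \<in> {1..n}" and "s > 0" and "e > 0"
  shows "avg_freshness M X i = ereal (s / (real n * e) * (1 - (s / (s + e)) ^ n))"
proof -
  have n: "n > 0" using i by auto
  define \<rho> where "\<rho> = s / (s + e)"
  have \<rho>: "(s + e) * \<rho> = s"
    using assms by (simp add: \<rho>_def)
  \<comment> \<open>A particular solution \<open>real m / e - s / e\<^sup>2\<close> of the
    recurrence plus a multiple of the homogeneous solution \<open>\<rho> ^ m\<close>, the multiple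
    being fixed by \<open>x 0 = 0\<close>.\<close>
  define x where "x m = real m / e - s / e\<^sup>2 * (1 - \<rho> ^ m)" for m
  have x_Suc: "(s + e) * x (Suc m) = real (Suc m) + s * x m" for m
  proof -
    have "(s + e) * x (Suc m) = (s + e) * real (Suc m) / e - s / e\<^sup>2 * ((s + e) - ((s + e) * \<rho>) * \<rho> ^ m)"
      by (simp add: x_def divide_inverse algebra_simps)
    also have "\<dots> = real (Suc m) + s * x m"
      unfolding \<rho> x_def using \<open>e > 0\<close> by (simp add: field_simps power2_eq_square)
    finally show ?thesis .
  qed
  have "avg_freshness M X i = ereal (1 - e * (x (n - 0) / real (n - 0)))"
  proof (rule avg_freshness_fresh_set[where w = "\<lambda>k. x (n - k) / real (n - k)", OF X[unfolded DC_RC_def] i])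
    fix k assume "k < n"
    then obtain m where m: "n - k = Suc m" "n - Suc k = m" "real n - real k = real (Suc m)"
      by (metis Suc_diff_Suc of_nat_diff less_imp_le)
    have "(e + s) * (x (Suc m) / real (Suc m)) = 1 + s / real (Suc m) * x m"
      using x_Suc[of m] by (simp add: field_simps del: of_nat_Suc)
    \<comment> \<open>When \<open>m = 0\<close> the node is the last stale one; both sides vanish
      because \<open>x 0 = 0\<close>.\<close>
    moreover have "real m * (s / real (Suc m)) * (x m / real m) = s / real (Suc m) * x m"
      by (cases "m = 0") (simp_all add: x_def del: of_nat_Suc)
    ultimately show "(e + real (n - k) * (s / (real n - real k))) * (x (n - k) / real (n - k))
        = 1 + real (n - k - 1) * (s / (real n - real k)) * (x (n - Suc k) / real (n - Suc k))"
      unfolding m by (simp add: m del: of_nat_Suc)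
  qed
  also have "1 - e * (x (n - 0) / real (n - 0)) = s / (real n * e) * (1 - \<rho> ^ n)"
    using n \<open>e > 0\<close> by (simp add: x_def field_simps power2_eq_square)
  finally show ?thesis by (simp add: \<rho>_def)
qed

theorem mainTheorem3:
  fixes n :: nat and lam_s lam_e :: real
  assumes "n \<ge> 2" and "lam_s > 0" and "lam_e > 0"
  shows "(\<forall>(M :: 'a measure) (S :: real \<Rightarrow> 'a \<Rightarrow> nat set)
            (M' :: 'b measure) (S' :: real \<Rightarrow> 'b \<Rightarrow> nat set). \<forall>i\<in>{1..n}.
            DC_RC n lam_s lam_e M S \<longrightarrow> DC_noRC n lam_s lam_e M' S' \<longrightarrow>
            avg_freshness M S i > avg_freshness M' S' i)
    \<and> lam_s / (real n * lam_e) * (1 - (lam_s / (lam_s + lam_e)) ^ n)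
        > lam_s / (lam_s + real n * lam_e)"
  using rate_changing_gt_traditional[OF assms] assms
  by (auto simp: avg_freshness_DC_RC avg_freshness_DC_noRC)

end
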